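(* Let $B=5$, let $\tilde p\neq0$ be an integer and $\tilde q$ a positive integer with $\tilde q\geqslant 3600\sqrt[3]{|\tilde p|}$. Let $F_1=B^{2}\tilde q^{6}+2B\tilde q^{4}-2B\tilde p\tilde q^{3}-2\tilde q^{2}-2\tilde p\tilde q+\tilde p^{2}+\frac5B-\frac{20}{B^{2}\tilde q^{2}}$, and consider the set of real $t$ with $F_1+\frac{10\tilde p}{B^{2}\tilde q^{3}}<t<F_1$ if $\tilde p<0$, respectively $F_1<t<F_1+\frac{10\tilde p}{B^{2}\tilde q^{3}}$ if $\tilde p>0$. This set contains at most one integer; an integer can occur only when $\tilde p>0$, and then it is $t=25\tilde q^{6}+10\tilde q^{4}-10\tilde p\tilde q^{3}-2\tilde q^{2}-2\tilde p\tilde q+\tilde p^{2}+1$. *)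

theory Defs
  imports Complex_Main
begin

definition F1 :: "real \<Rightarrow> int \<Rightarrow> int \<Rightarrow> real" where
  "F1 B p q = B^2 * q^6 + 2 * B * q^4 - 2 * B * p * q^3 - 2 * q^2 - 2 * p * q + p^2
     + 5 / B - 20 / (B^2 * q^2)"

definition t_set :: "real \<Rightarrow> int \<Rightarrow> int \<Rightarrow> real set" where
  "t_set B p q =
     {t. (p < 0 \<and> F1 B p q + 10 * p / (B^2 * q^3) < t \<and> t < F1 B p q) \<or>
         (p > 0 \<and> F1 B p q < t \<and> t < F1 B p q + 10 * p / (B^2 * q^3))}"

end

theory Submission imports Defs begin

text \<open>For \<open>B = 5\<close> the number \<open>F1 B p q\<close> is an integer \<open>m\<close> minus \<open>20/(25 q\<^sup>2)\<close>.
  The lower bound on \<open>q\<close> makes both this correction and the length \<open>10\<bar>p\<bar>/(25 q\<^sup>3)\<close> of the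
  interval smaller than \<open>1/2\<close>. Hence for \<open>p < 0\<close> the interval lies strictly between \<open>m - 1\<close>
  and \<open>m\<close>, while for \<open>p > 0\<close> it lies strictly between \<open>m - 1\<close> and \<open>m + 1\<close>.\<close>

lemma cube_bound_of_root_bound:
  fixes p q :: int
  assumes "real_of_int q \<ge> 3600 * root 3 \<bar>real_of_int p\<bar>"
  shows "\<bar>real_of_int p\<bar> \<le> real_of_int q ^ 3"
proof -
  have r: "root 3 \<bar>real_of_int p\<bar> \<ge> 0" by simp
  have "root 3 \<bar>real_of_int p\<bar> ^ 3 \<le> real_of_int q ^ 3"
    by (rule power_mono) (use assms r in linarith)+
  then show ?thesis by simp
qed

text \<open>The choice \<open>B = 5\<close> turns the term \<open>5 / B\<close> into 1, so only the
  last term of \<open>F1\<close> can fail to be an integer.\<close>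

lemma F1_5:
  "F1 5 p q = real_of_int (25 * q^6 + 10 * q^4 - 10 * p * q^3 - 2 * q^2 - 2 * p * q + p^2 + 1)
     - 20 / (25 * real_of_int q ^ 2)"
  by (simp add: F1_def)

lemma t_set_5_int:
  fixes p q n :: int
  assumes p: "p \<noteq> 0" and q: "q > 0"
    and root: "real_of_int q \<ge> 3600 * root 3 \<bar>real_of_int p\<bar>"
    and n: "real_of_int n \<in> t_set 5 p q"
  shows "p > 0 \<and> n = 25 * q^6 + 10 * q^4 - 10 * p * q^3 - 2 * q^2 - 2 * p * q + p^2 + 1"
proof -
  define m where "m = 25 * q^6 + 10 * q^4 - 10 * p * q^3 - 2 * q^2 - 2 * p * q + p^2 + 1"
  define a where "a = 20 / (25 * real_of_int q ^ 2)"
  define b where "b = 10 * real_of_int p / (25 * real_of_int q ^ 3)"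
  have F: "F1 5 p q = real_of_int m - a"
    by (simp add: F1_5 m_def a_def)
  \<comment> \<open>A nonzero integer has absolute value at least 1, which keeps \<open>q\<close>
    away from 1; \<open>q\<close> \<ge> 2 already gives \<open>a\<close> \<le> 1/5.\<close>
  have "1 \<le> root 3 \<bar>real_of_int p\<bar>"
    using p by simp
  with root have "real_of_int q \<ge> 2" by linarith
  then have "real_of_int q ^ 2 \<ge> 2 ^ 2" by (intro power_mono) auto
  moreover have "real_of_int q ^ 2 > 0" using q by simp
  ultimately have a: "0 < a" "a < 1/2"
    by (simp_all add: a_def divide_less_eq)
  have "real_of_int q ^ 3 > 0" using q by simp
  \<comment> \<open>This is \<open>\<bar>b\<bar> < 1/2\<close> with denominators cleared, as
    \<open>b\<close> = 2\<open>p\<close>/(5\<open>q^3\<close>).\<close>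
  then have "4 * \<bar>real_of_int p\<bar> < 5 * real_of_int q ^ 3"
    using cube_bound_of_root_bound[OF root] by linarith
  then have b: "\<bar>b\<bar> < 1/2"
    using q by (simp add: b_def abs_mult divide_less_eq)
  have "(p < 0 \<and> real_of_int m - a + b < n \<and> n < real_of_int m - a) \<or>
        (p > 0 \<and> real_of_int m - a < n \<and> n < real_of_int m - a + b)"
    using n by (simp add: t_set_def F b_def)
  then consider "p < 0" "real_of_int m - 1 < n" "real_of_int n < m"
    | "p > 0" "real_of_int m - 1 < n" "real_of_int n < m + 1"
    using a b by linarith
  then have "p > 0 \<and> n = m"
    by cases auto
  then show ?thesis by (simp add: m_def)
qed

theorem theorem7p4:
  fixes B :: real and p q :: int
  assumes "B = 5"
    and "p \<noteq> 0"
    and "q > 0"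
    and "real_of_int q \<ge> 3600 * root 3 \<bar>real_of_int p\<bar>"
  shows "(\<exists>\<^sub>\<le>\<^sub>1 n :: int. real_of_int n \<in> t_set B p q) \<and>
    (\<forall>n :: int. real_of_int n \<in> t_set B p q \<longrightarrow>
      p > 0 \<and>
      n = 25 * q^6 + 10 * q^4 - 10 * p * q^3 - 2 * q^2 - 2 * p * q + p^2 + 1)"
  \<comment> \<open>Any two integers in the set equal the same explicit value, hence each
    other.\<close>
  using t_set_5_int[OF assms(2-4)] unfolding assms(1) Uniq_def by blast

end
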